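(* Let $\mathbb{L}^2$ be as described in the context and $M=\mathbb{R}^+\times\mathbb{R}$. Then: (1) For any $P\in M$, the exponential map $\exp_P$, on its domain of definition in $T_PM$, is an embedding. (2) $\exp_P$ is not onto; it omits a region in the plane. (3) For $P=(1,0)$, the image of $\exp_P$ omits the regions $\{x^2\ge 1+x^1\}$ and $\{x^2\le -1-x^1\}$.
   Context: $\mathbb{L}^2$ is $M=\mathbb{R}^+\times\mathbb{R}=\{(x^1,x^2):x^1>0\}$ with the torsion free connection whose nonzero Christoffel symbols (with $\nabla_{\partial_{x^i}}\partial_{x^j}=\Gamma_{ij}{}^k\partial_{x^k}$) are $\Gamma_{11}{}^1=-\frac1{x^1}$, $\Gamma_{12}{}^2=\Gamma_{21}{}^2=-\frac1{x^1}$, $\Gamma_{22}{}^1=-\frac1{x^1}$; it is the Levi--Civita connection of the Lorentzian metric $(x^1)^{-2}(-(dx^1)^2+(dx^2)^2)$. This connection is geodesically incomplete, so $\exp_P$ is defined only on an open subset of $T_PM$. *)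

theory Defs
  imports "HOL-Analysis.Analysis"
begin

text \<open>The half plane M = R+ x R; points and tangent vectors are pairs of
  coordinates (x1, x2), a tangent vector (v1,v2) meaning v1 d/dx1 + v2 d/dx2.\<close>

definition M :: "(real \<times> real) set" where
  "M = {p. fst p > 0}"

text \<open>Geodesic acceleration x''^k = - Gamma_ij^k x'^i x'^j for the connection with
  Gamma_11^1 = Gamma_12^2 = Gamma_21^2 = Gamma_22^1 = -1/x1 (all others zero).\<close>

definition geod_acc :: "real \<times> real \<Rightarrow> real \<times> real \<Rightarrow> real \<times> real" where
  "geod_acc p v = (((fst v)\<^sup>2 + (snd v)\<^sup>2) / fst p, 2 * fst v * snd v / fst p)"

definition geodesic_on ::
  "real set \<Rightarrow> (real \<Rightarrow> real \<times> real) \<Rightarrow> (real \<Rightarrow> real \<times> real) \<Rightarrow> bool" where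
  "geodesic_on I \<gamma> \<gamma>' \<longleftrightarrow>
     (\<forall>t\<in>I. \<gamma> t \<in> M
        \<and> (\<gamma> has_vector_derivative \<gamma>' t) (at t within I)
        \<and> (\<gamma>' has_vector_derivative geod_acc (\<gamma> t) (\<gamma>' t)) (at t within I))"

definition exp_dom :: "real \<times> real \<Rightarrow> (real \<times> real) set" where
  "exp_dom P = {v. \<exists>\<gamma> \<gamma>'. geodesic_on {0..1} \<gamma> \<gamma>' \<and> \<gamma> 0 = P \<and> \<gamma>' 0 = v}"

definition expmap :: "real \<times> real \<Rightarrow> real \<times> real \<Rightarrow> real \<times> real" where
  "expmap P v = (SOME \<gamma>. \<exists>\<gamma>'. geodesic_on {0..1} \<gamma> \<gamma>' \<and> \<gamma> 0 = P \<and> \<gamma>' 0 = v) 1"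

coinductive smooth_on :: "('a::real_normed_vector) set \<Rightarrow> ('a \<Rightarrow> 'b::real_normed_vector) \<Rightarrow> bool"
  for S where
  "\<lbrakk>\<forall>x\<in>S. f differentiable (at x);
    \<forall>u. smooth_on S (\<lambda>x. frechet_derivative f (at x) u)\<rbrakk> \<Longrightarrow> smooth_on S f"

definition smooth_embedding :: "(real \<times> real) set \<Rightarrow> (real \<times> real \<Rightarrow> real \<times> real) \<Rightarrow> bool" where
  "smooth_embedding S f \<longleftrightarrow>
     smooth_on S f
     \<and> (\<forall>x\<in>S. inj (frechet_derivative f (at x)))
     \<and> (\<exists>g. homeomorphism S (f ` S) f g)"

end

theory Submission
  imports Defs
begin

text \<open>Along a geodesic \<open>(x, y)\<close> the quantities \<open>e = (y'\<^sup>2 - x'\<^sup>2) / x\<^sup>2\<close> and \<open>y' / x\<^sup>2\<close> are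
  constant, and \<open>u = 1 / x\<close> solves the linear equation \<open>u'' = - e u\<close>. Hence, with
  \<open>C = cos (sqrt e)\<close> and \<open>S = sin (sqrt e) / sqrt e\<close> (entire functions of \<open>e\<close>), the exponential map at
  \<open>(a, b)\<close> sends \<open>v\<close> to \<open>(a / W, b + v\<^sub>2 S / W)\<close> where \<open>W = C - v\<^sub>1 S / a\<close>, on the open domain
  \<open>e < \<pi>\<^sup>2\<close>, \<open>W > 0\<close>.
  The relation \<open>C\<^sup>2 + e S\<^sup>2 = 1\<close> gives \<open>2 W C = 1 + W\<^sup>2 - B\<^sup>2\<close> with \<open>B = v\<^sub>2 S / a\<close>, so the image point
  determines \<open>C\<close>; since \<open>C\<close> is strictly decreasing in \<open>e < \<pi>\<^sup>2\<close>, it determines \<open>e\<close>, and then \<open>v\<close>. The same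
  computation at the level of derivatives shows that the differential is injective, and invariance
  of domain makes the map a homeomorphism onto its image. Finally \<open>C > -1\<close> says
  \<open>\<bar>B\<bar> < 1 + W\<close>, which bounds the image.\<close>

section \<open>Power series for cosine and sine of a square root\<close>

text \<open>The \<open>k\<close>-th derivative of the entire function \<open>z \<mapsto> cos (sqrt z)\<close>; \<open>sincq\<close> below is
  \<open>z \<mapsto> sin (sqrt z) / sqrt z\<close>.\<close>

definition cosq_deriv :: "nat \<Rightarrow> real \<Rightarrow> real" where
  "cosq_deriv k z = (\<Sum>n. (diffs ^^ k) (\<lambda>n. (-1) ^ n / fact (2 * n)) n * z ^ n)"

abbreviation cosq :: "real \<Rightarrow> real" where "cosq \<equiv> cosq_deriv 0"

definition sincq :: "real \<Rightarrow> real" where "sincq z = -2 * cosq_deriv 1 z"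

lemma cosq_square_sums: "(\<lambda>n. (-1) ^ n / fact (2 * n) * (x\<^sup>2) ^ n) sums cos (x :: real)"
  using cos_paired[of x] by (simp add: power_mult)

lemma cosq_neg_square_sums:
  "(\<lambda>n. (-1) ^ n / fact (2 * n) * (- (x\<^sup>2)) ^ n) sums cosh (x :: real)"
proof -
  have "(\<lambda>n. if even n then x ^ n /\<^sub>R fact n else 0) sums cosh x"
    by (rule cosh_converges)
  \<comment> \<open>The odd terms of the series of cosh vanish, so it may be reindexed along n ->
    2n.\<close>
  then have "(\<lambda>n. if even (2 * n) then x ^ (2 * n) /\<^sub>R fact (2 * n) else 0) sums cosh x"
    by (subst sums_mono_reindex) (auto simp: strict_mono_def elim!: evenE)
  moreover have "(if even (2 * n) then x ^ (2 * n) /\<^sub>R fact (2 * n) else 0)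
      = (-1) ^ n / fact (2 * n) * (- (x\<^sup>2)) ^ n" for n
    by (cases "even n") (simp_all add: power_mult divide_inverse)
  ultimately show ?thesis by simp
qed

lemma cosq_square: "cosq (x\<^sup>2) = cos x"
  using cosq_square_sums[of x] by (simp add: cosq_deriv_def sums_iff)

lemma cosq_neg_square: "cosq (- (x\<^sup>2)) = cosh x"
  using cosq_neg_square_sums[of x] by (simp add: cosq_deriv_def sums_iff)

text \<open>Case split behind the facts about \<open>cosq\<close> and \<open>sincq\<close>:
  trigonometric functions for positive arguments, hyperbolic ones for negative arguments, direct
  evaluation at 0.\<close>

lemma real_square_cases:
  fixes z :: real
  obtains (pos) x where "x > 0" "z = x\<^sup>2" | (zero) "z = 0" | (neg) x where "x > 0" "z = - (x\<^sup>2)"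
proof -
  consider "z > 0" | "z = 0" | "z < 0" by linarith
  then show thesis
  proof cases
    case 1 then show thesis using pos[of "sqrt z"] by simp
  next
    case 2 then show thesis by (rule zero)
  next
    case 3 then show thesis using neg[of "sqrt (- z)"] by simp
  qed
qed

text \<open>Every real is plus or minus a square, so the series is one of those already summed to
  cos or cosh.\<close>

lemma cosq_coeff_summable: "summable (\<lambda>n. (-1) ^ n / fact (2 * n) * (z :: real) ^ n)"
proof (cases z rule: real_square_cases)
  case (pos x) then show ?thesis using cosq_square_sums sums_summable by blast
next
  case zero then show ?thesis using cosq_square_sums[of 0] sums_summable by fastforce
next
  case (neg x) then show ?thesis using cosq_neg_square_sums sums_summable by blast
qed

lemma cosq_deriv_summable:
  "summable (\<lambda>n. (diffs ^^ k) (\<lambda>n. (-1) ^ n / fact (2 * n)) n * (z :: real) ^ n)"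
proof (induction k arbitrary: z)
  case 0 show ?case using cosq_coeff_summable by simp
next
  case (Suc k) then show ?case using termdiff_converges_all[of _ z] by simp
qed

lemma cosq_deriv_has_derivative: "(cosq_deriv k has_real_derivative cosq_deriv (Suc k) z) (at z)"
  using termdiffs_strong_converges_everywhere[OF cosq_deriv_summable, of k z]
  by (simp add: cosq_deriv_def[abs_def])

lemma cosq_DERIV [derivative_intros]:
  assumes "(g has_real_derivative m) (at x within s)"
  shows "((\<lambda>x. cosq (g x)) has_real_derivative (- sincq (g x) / 2 * m)) (at x within s)"
  using DERIV_chain2[OF cosq_deriv_has_derivative assms, of 0] by (simp add: sincq_def)

lemma sincq_DERIV [derivative_intros]:
  assumes "(g has_real_derivative m) (at x within s)"
  shows "((\<lambda>x. sincq (g x)) has_real_derivative (-2 * cosq_deriv 2 (g x) * m)) (at x within s)"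
  unfolding sincq_def
  using DERIV_cmult[OF DERIV_chain2[OF cosq_deriv_has_derivative assms, of 1], of "-2"]
  by (simp add: numeral_2_eq_2 mult.assoc)

text \<open>Differentiate \<open>cosq (x\<^sup>2) = cos x\<close> in two ways. The chain rule
  produces \<open>- x * sincq (x\<^sup>2)\<close>, since the factor -2 in \<open>sincq\<close>
  cancels against the derivative 2x of the square.\<close>

lemma sincq_square: "x * sincq (x\<^sup>2) = sin x"
proof -
  have "((\<lambda>x. cosq (x\<^sup>2)) has_real_derivative (- sincq (x\<^sup>2) / 2 * (2 * x))) (at x)"
    by (auto intro!: derivative_eq_intros)
  moreover have "((\<lambda>x. cosq (x\<^sup>2)) has_real_derivative - sin x) (at x)"
    unfolding cosq_square by (auto intro!: derivative_eq_intros)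
  ultimately show ?thesis using DERIV_unique by fastforce
qed

lemma sincq_neg_square: "x * sincq (- (x\<^sup>2)) = sinh x"
proof -
  have "((\<lambda>x. cosq (- (x\<^sup>2))) has_real_derivative (- sincq (- (x\<^sup>2)) / 2 * (- 2 * x))) (at x)"
    by (auto intro!: derivative_eq_intros)
  moreover have "((\<lambda>x. cosq (- (x\<^sup>2))) has_real_derivative sinh x) (at x)"
    unfolding cosq_neg_square by (auto intro!: derivative_eq_intros)
  ultimately show ?thesis using DERIV_unique by fastforce
qed

lemma cosq_0 [simp]: "cosq 0 = 1"
  using cosq_square[of 0] by simp

lemma sincq_0 [simp]: "sincq 0 = 1"
proof -
  have "cosq_deriv 1 0 = diffs (\<lambda>n. (-1) ^ n / fact (2 * n)) 0"
    unfolding cosq_deriv_def by (subst powser_zero) simp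
  then show ?thesis by (simp add: sincq_def diffs_def)
qed

lemma cosq_sincq_pythagoras: "(cosq z)\<^sup>2 + z * (sincq z)\<^sup>2 = 1"
proof (cases z rule: real_square_cases)
  case (pos x)
  then show ?thesis using cosq_square[of x] sincq_square[of x] sin_cos_squared_add2[of x]
    by (metis power_mult_distrib)
next
  case (neg x)
  have "(cosq z)\<^sup>2 + z * (sincq z)\<^sup>2 = (cosh x)\<^sup>2 - (x * sincq (- (x\<^sup>2)))\<^sup>2"
    by (simp add: neg cosq_neg_square power_mult_distrib)
  then show ?thesis by (simp add: sincq_neg_square cosh_square_eq)
qed simp

text \<open>In terms of f = \<open>cosq\<close> this is 4 z f'' + 2 f' + f = 0. It comes from
  computing the derivative of \<open>x * sincq (c * x\<^sup>2)\<close> twice for c = 1 and c = -1,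
  where the function is sin or sinh. It is what makes \<open>osc_cos\<close> the derivative of
  \<open>osc_sin\<close>.\<close>

lemma sincq_ode: "sincq z - 4 * z * cosq_deriv 2 z = cosq z"
proof -
  have *: "((\<lambda>x. x * sincq (c * x\<^sup>2)) has_real_derivative
      sincq (c * x\<^sup>2) - 4 * (c * x\<^sup>2) * cosq_deriv 2 (c * x\<^sup>2)) (at x)" for c x
    by (auto intro!: derivative_eq_intros simp: power2_eq_square)
  show ?thesis
  proof (cases z rule: real_square_cases)
    case (pos x)
    have "((\<lambda>x. x * sincq (1 * x\<^sup>2)) has_real_derivative cosq z) (at x)"
      by (simp add: sincq_square pos cosq_square DERIV_sin)
    then show ?thesis using DERIV_unique[OF *[of 1]] pos by auto
  next
    case (neg x)
    have "((\<lambda>x. x * sincq (- 1 * x\<^sup>2)) has_real_derivative cosq z) (at x)"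
      by (auto simp: sincq_neg_square neg cosq_neg_square intro!: derivative_eq_intros)
    then show ?thesis using DERIV_unique[OF *[of "-1"]] neg by auto
  qed simp
qed

lemma sincq_pos:
  assumes "z < pi\<^sup>2" shows "sincq z > 0"
proof (cases z rule: real_square_cases)
  case (pos x)
  then have "x < pi" using assms by (simp add: power2_less_imp_less)
  then have "x * sincq z > 0" using pos sincq_square[of x] sin_gt_zero by simp
  then show ?thesis using pos zero_less_mult_pos by blast
next
  case (neg x)
  then have "x * sincq z > 0" using sincq_neg_square[of x] by simp
  then show ?thesis using neg zero_less_mult_pos by blast
qed simp

lemma cosq_strict_antimono:
  assumes "y < z" "z < pi\<^sup>2" shows "cosq z < cosq y"
proof (rule DERIV_neg_imp_decreasing[OF assms(1)])
  fix x assume "y \<le> x" "x \<le> z"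
  then have "- sincq x / 2 * 1 < 0" using sincq_pos[of x] assms by simp
  moreover have "(cosq has_real_derivative (- sincq x / 2 * 1)) (at x)"
    using cosq_DERIV[OF DERIV_ident] .
  ultimately show "\<exists>d. (cosq has_real_derivative d) (at x) \<and> d < 0" by blast
qed

text \<open>Below 0 the function is a cosh; between 0 and \<open>pi\<^sup>2\<close> it is a cosine
  that has not yet reached its minimum at pi.\<close>

lemma cosq_gt_minus_one:
  assumes "z < pi\<^sup>2" shows "cosq z > -1"
proof (cases z rule: real_square_cases)
  case (pos x)
  then have "x < pi" using assms by (simp add: power2_less_imp_less)
  then show ?thesis using pos cos_monotone_0_pi[of x pi] by (simp add: cosq_square)
next
  case (neg x)
  then show ?thesis using cosh_real_ge_1[of x] by (simp add: cosq_neg_square)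
qed simp

section \<open>The linear oscillator u'' = - e u\<close>

text \<open>\<open>osc_cos\<close> and \<open>osc_sin\<close> are the fundamental solutions of u'' =
  - e u, with initial data (1, 0) and (0, 1), uniformly in the sign of e.\<close>

definition osc_cos :: "real \<Rightarrow> real \<Rightarrow> real" where "osc_cos e t = cosq (e * t\<^sup>2)"
definition osc_sin :: "real \<Rightarrow> real \<Rightarrow> real" where "osc_sin e t = t * sincq (e * t\<^sup>2)"

lemma osc_cos_DERIV [derivative_intros]:
  "(osc_cos e has_real_derivative - e * osc_sin e t) (at t within s)"
  unfolding osc_cos_def[abs_def] osc_sin_def
  by (auto intro!: derivative_eq_intros)

lemma osc_sin_DERIV [derivative_intros]:
  "(osc_sin e has_real_derivative osc_cos e t) (at t within s)"
proof -
  have "((\<lambda>t. t * sincq (e * t\<^sup>2)) has_real_derivative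
      sincq (e * t\<^sup>2) - 4 * (e * t\<^sup>2) * cosq_deriv 2 (e * t\<^sup>2)) (at t within s)"
    by (auto intro!: derivative_eq_intros simp: power2_eq_square)
  then show ?thesis unfolding sincq_ode by (simp add: osc_sin_def[abs_def] osc_cos_def)
qed

lemma osc_0 [simp]: "osc_cos e 0 = 1" "osc_sin e 0 = 0"
  by (simp_all add: osc_cos_def osc_sin_def)

lemma osc_pythagoras: "(osc_cos e t)\<^sup>2 + e * (osc_sin e t)\<^sup>2 = 1"
  using cosq_sincq_pythagoras[of "e * t\<^sup>2"]
  by (simp add: osc_cos_def osc_sin_def power_mult_distrib mult_ac)

lemma osc_sin_pos:
  assumes "e < pi\<^sup>2" "0 < t" "t \<le> 1" shows "osc_sin e t > 0"
proof -
  have "e * t\<^sup>2 < pi\<^sup>2"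
  proof (cases "e \<le> 0")
    case True then have "e * t\<^sup>2 \<le> 0" by (simp add: mult_nonpos_nonneg)
    then show ?thesis using pi_gt_zero by (smt (verit) zero_less_power)
  next
    case False
    then have "e * t\<^sup>2 \<le> e * 1" using assms by (intro mult_left_mono) (auto simp: power_le_one)
    then show ?thesis using assms by simp
  qed
  then show ?thesis using sincq_pos assms by (simp add: osc_sin_def)
qed

lemma DERIV_zero_eq:
  fixes f :: "real \<Rightarrow> real"
  assumes "convex I" "a \<in> I" "b \<in> I"
    and "\<And>s. s \<in> I \<Longrightarrow> (f has_real_derivative 0) (at s within I)"
  shows "f b = f a"
  using has_field_derivative_zero_constant[OF assms(1,4)] assms(2,3) by auto

text \<open>With v = u', the Wronskians of u against the two fundamental solutions have derivative
  zero, so they keep their initial values. Derivatives are taken within I, so one-sided ones at the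
  endpoints suffice.\<close>

lemma oscillator_unique:
  fixes u v :: "real \<Rightarrow> real"
  assumes "convex I" "0 \<in> I" "t \<in> I"
    and u: "\<And>s. s \<in> I \<Longrightarrow> (u has_real_derivative v s) (at s within I)"
    and v: "\<And>s. s \<in> I \<Longrightarrow> (v has_real_derivative - e * u s) (at s within I)"
  shows "u t = u 0 * osc_cos e t + v 0 * osc_sin e t"
proof -
  have "((\<lambda>s. u s * (- e * osc_sin e s) - v s * osc_cos e s) has_real_derivative 0) (at s within I)"
    if "s \<in> I" for s
    by (auto intro!: derivative_eq_intros u[OF that] v[OF that] simp: algebra_simps)
  then have 1: "u t * (- e * osc_sin e t) - v t * osc_cos e t = - v 0"
    using DERIV_zero_eq[OF assms(1-3), of "\<lambda>s. u s * (- e * osc_sin e s) - v s * osc_cos e s"] by simp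
  have "((\<lambda>s. u s * osc_cos e s - v s * osc_sin e s) has_real_derivative 0) (at s within I)"
    if "s \<in> I" for s
    by (auto intro!: derivative_eq_intros u[OF that] v[OF that] simp: algebra_simps)
  then have 2: "u t * osc_cos e t - v t * osc_sin e t = u 0"
    using DERIV_zero_eq[OF assms(1-3), of "\<lambda>s. u s * osc_cos e s - v s * osc_sin e s"] by simp
  \<comment> \<open>Eliminating \<open>v t\<close> from the two constants leaves \<open>u t\<close>
    times the Pythagorean sum.\<close>
  have "u 0 * osc_cos e t - (- v 0) * osc_sin e t = u t * ((osc_cos e t)\<^sup>2 + e * (osc_sin e t)\<^sup>2)"
    unfolding 1[symmetric] 2[symmetric] by (simp add: algebra_simps power2_eq_square)
  then show ?thesis by (simp add: osc_pythagoras)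
qed

section \<open>Closed form of the geodesics\<close>

lemma geodesic_on_components:
  "geodesic_on I \<gamma> \<gamma>' \<longleftrightarrow> (\<forall>t\<in>I. fst (\<gamma> t) > 0
     \<and> ((\<lambda>t. fst (\<gamma> t)) has_real_derivative fst (\<gamma>' t)) (at t within I)
     \<and> ((\<lambda>t. snd (\<gamma> t)) has_real_derivative snd (\<gamma>' t)) (at t within I)
     \<and> ((\<lambda>t. fst (\<gamma>' t)) has_real_derivative
          ((fst (\<gamma>' t))\<^sup>2 + (snd (\<gamma>' t))\<^sup>2) / fst (\<gamma> t)) (at t within I)
     \<and> ((\<lambda>t. snd (\<gamma>' t)) has_real_derivative
          2 * fst (\<gamma>' t) * snd (\<gamma>' t) / fst (\<gamma> t)) (at t within I))"
proof -
  have *: "(f has_vector_derivative d) (at t within I) \<longleftrightarrow>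
      ((\<lambda>t. fst (f t)) has_vector_derivative fst d) (at t within I) \<and>
      ((\<lambda>t. snd (f t)) has_vector_derivative snd d) (at t within I)"
    for f :: "real \<Rightarrow> real \<times> real" and d t
    using has_vector_derivative_Pair[of "\<lambda>t. fst (f t)" "fst d" t I "\<lambda>t. snd (f t)" "snd d"]
      bounded_linear.has_vector_derivative[OF bounded_linear_fst, of f d "at t within I"]
      bounded_linear.has_vector_derivative[OF bounded_linear_snd, of f d "at t within I"]
    by auto
  show ?thesis
    by (simp add: geodesic_on_def M_def geod_acc_def *
        has_real_derivative_iff_has_vector_derivative conj_ac)
qed

text \<open>The Lorentzian square g(v, v) of a tangent vector at a point with first coordinate
  \<open>a\<close>.\<close>

definition energy :: "real \<Rightarrow> real \<times> real \<Rightarrow> real" where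
  "energy a v = ((snd v)\<^sup>2 - (fst v)\<^sup>2) / a\<^sup>2"

text \<open>The oscillator solution with value 1 and slope - v1 / a at time 0; along a geodesic it
  is the ratio a / x.\<close>

definition denom :: "real \<Rightarrow> real \<times> real \<Rightarrow> real \<Rightarrow> real" where
  "denom a v t = osc_cos (energy a v) t - fst v / a * osc_sin (energy a v) t"

definition geod :: "real \<times> real \<Rightarrow> real \<times> real \<Rightarrow> real \<Rightarrow> real \<times> real" where
  "geod P v t = (fst P / denom (fst P) v t,
     snd P + snd v * osc_sin (energy (fst P) v) t / denom (fst P) v t)"

lemma denom_DERIV:
  "(denom a v has_real_derivative
     - energy a v * osc_sin (energy a v) t - fst v / a * osc_cos (energy a v) t) (at t within s)"
  unfolding denom_def[abs_def]
  by (intro DERIV_diff DERIV_cmult osc_cos_DERIV osc_sin_DERIV)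

text \<open>The Wronskian of two solutions of the same oscillator, hence constant in t; written out,
  it is the Pythagorean relation. It is the numerator in the derivative of
  \<open>osc_sin / denom\<close>.\<close>

lemma osc_denom_wronskian:
  "osc_cos (energy a v) t * denom a v t - osc_sin (energy a v) t *
    (- energy a v * osc_sin (energy a v) t - fst v / a * osc_cos (energy a v) t) = 1"
  using osc_pythagoras[of "energy a v" t]
  by (simp add: denom_def algebra_simps power2_eq_square)

lemma osc_sin_over_denom_DERIV:
  assumes "denom a v t \<noteq> 0"
  shows "((\<lambda>t. osc_sin (energy a v) t / denom a v t) has_real_derivative 1 / (denom a v t)\<^sup>2)
    (at t within s)"
  using DERIV_divide[OF osc_sin_DERIV[of "energy a v" t s] denom_DERIV assms]
  by (simp only: osc_denom_wronskian power2_eq_square)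

text \<open>Uniqueness of geodesics: the conserved quantities reduce the system to the linear
  oscillator and one integration. Positivity of \<open>denom\<close> reflects that the geodesic
  stays in \<open>M\<close>.\<close>

lemma geodesic_is_geod:
  assumes g: "geodesic_on {0..1} \<gamma> \<gamma>'" and t: "t \<in> {0..1}"
  shows "denom (fst (\<gamma> 0)) (\<gamma>' 0) t > 0" "\<gamma> t = geod (\<gamma> 0) (\<gamma>' 0) t"
proof -
  define I where "I = {0..1::real}"
  have I: "convex I" "0 \<in> I" by (auto simp: I_def)
  define x y x' y' where "x = (\<lambda>t. fst (\<gamma> t))" "y = (\<lambda>t. snd (\<gamma> t))"
    "x' = (\<lambda>t. fst (\<gamma>' t))" "y' = (\<lambda>t. snd (\<gamma>' t))"
  note xy_def = this
  have pos: "x s > 0" and dx: "(x has_real_derivative x' s) (at s within I)"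
    and dy: "(y has_real_derivative y' s) (at s within I)"
    and dx': "(x' has_real_derivative ((x' s)\<^sup>2 + (y' s)\<^sup>2) / x s) (at s within I)"
    and dy': "(y' has_real_derivative 2 * x' s * y' s / x s) (at s within I)" if "s \<in> I" for s
    using g that unfolding geodesic_on_components xy_def I_def by auto
  let ?a = "x 0" and ?v = "\<gamma>' 0"
  define e where "e = energy ?a ?v"
  have "((\<lambda>s. ((y' s)\<^sup>2 - (x' s)\<^sup>2) / (x s)\<^sup>2) has_real_derivative 0) (at s within I)"
    if "s \<in> I" for s
    by (rule derivative_eq_intros dx[OF that] dx'[OF that] dy'[OF that] refl)+
      (use pos[OF that] in \<open>auto simp: field_simps power2_eq_square\<close>)
  then have e: "((y' s)\<^sup>2 - (x' s)\<^sup>2) / (x s)\<^sup>2 = e" if "s \<in> I" for s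
    using DERIV_zero_eq[OF I that, of "\<lambda>s. ((y' s)\<^sup>2 - (x' s)\<^sup>2) / (x s)\<^sup>2"]
    by (simp add: e_def energy_def xy_def)
  have u: "((\<lambda>s. 1 / x s) has_real_derivative - x' s / (x s)\<^sup>2) (at s within I)" if "s \<in> I" for s
    by (rule derivative_eq_intros dx[OF that] refl)+
      (use pos[OF that] in \<open>auto simp: field_simps power2_eq_square\<close>)
  \<comment> \<open>The second derivative of 1/x is (x'^2 - y'^2)/x^3, which conservation of the
    energy turns into - e/x.\<close>
  have u': "((\<lambda>s. - x' s / (x s)\<^sup>2) has_real_derivative - e * (1 / x s)) (at s within I)"
    if "s \<in> I" for s
    by (rule derivative_eq_intros dx[OF that] dx'[OF that] refl)+
      (use pos[OF that] in \<open>auto simp: e[OF that, symmetric] field_simps power2_eq_square\<close>)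
  have inv: "1 / x s = denom ?a ?v s / ?a" if "s \<in> I" for s
  proof -
    have "1 / x s = 1 / ?a * osc_cos e s + - x' 0 / ?a\<^sup>2 * osc_sin e s"
      using oscillator_unique[OF I that u u'] .
    also have "\<dots> = denom ?a ?v s / ?a"
      using pos[OF I(2)] by (simp add: denom_def e_def xy_def field_simps power2_eq_square)
    finally show ?thesis .
  qed
  have denom_eq: "denom ?a ?v s = ?a / x s" if "s \<in> I" for s
    using inv[OF that] pos[OF that] pos[OF I(2)] by (simp add: field_simps)
  have d: "denom ?a ?v s > 0" and x_eq: "x s = ?a / denom ?a ?v s" if "s \<in> I" for s
    using pos[OF that] pos[OF I(2)] by (simp_all add: denom_eq[OF that])
  have "((\<lambda>s. y' s / (x s)\<^sup>2) has_real_derivative 0) (at s within I)" if "s \<in> I" for s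
    by (rule derivative_eq_intros dx[OF that] dy'[OF that] refl)+
      (use pos[OF that] in \<open>auto simp: field_simps power2_eq_square\<close>)
  then have cs: "y' s / (x s)\<^sup>2 = y' 0 / ?a\<^sup>2" if "s \<in> I" for s
    using DERIV_zero_eq[OF I that, of "\<lambda>s. y' s / (x s)\<^sup>2"] by blast
  have y': "y' s = y' 0 * (1 / (denom ?a ?v s)\<^sup>2)" if "s \<in> I" for s
    using cs[OF that] pos[OF I(2)] pos[OF that]
    by (simp add: denom_eq[OF that] field_simps power_divide)
  \<comment> \<open>Since y' = y'(0) / denom^2, an antiderivative is y'(0) times
    \<open>osc_sin / denom\<close>.\<close>
  have "((\<lambda>s. y s - y' 0 * (osc_sin e s / denom ?a ?v s)) has_real_derivative 0) (at s within I)"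
    if "s \<in> I" for s
    unfolding e_def
    by (rule derivative_eq_intros dy[OF that] osc_sin_over_denom_DERIV refl)+
      (use d[OF that] y'[OF that] in auto)
  then have "y s - y' 0 * (osc_sin e s / denom ?a ?v s) = y 0 - y' 0 * (osc_sin e 0 / denom ?a ?v 0)"
    if "s \<in> I" for s
    using DERIV_zero_eq[OF I that, of "\<lambda>s. y s - y' 0 * (osc_sin e s / denom ?a ?v s)"] by blast
  then have y_eq: "y s = y 0 + y' 0 * osc_sin e s / denom ?a ?v s" if "s \<in> I" for s
    using that by (simp add: field_simps)
  have "t \<in> I" using t by (simp add: I_def)
  from d[OF this] show "denom (fst (\<gamma> 0)) (\<gamma>' 0) t > 0" by (simp add: xy_def)
  show "\<gamma> t = geod (\<gamma> 0) (\<gamma>' 0) t"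
    using x_eq[OF \<open>t \<in> I\<close>] y_eq[OF \<open>t \<in> I\<close>]
    by (simp add: geod_def xy_def e_def prod_eq_iff)
qed

text \<open>Existence: the closed form is checked against the geodesic equation wherever its
  denominator stays positive.\<close>

lemma geodesic_on_geod:
  assumes "fst P > 0" and d: "\<And>t. t \<in> I \<Longrightarrow> denom (fst P) v t > 0"
  shows "\<exists>\<gamma>'. geodesic_on I (geod P v) \<gamma>' \<and> \<gamma>' 0 = v"
proof -
  define a e S C where "a = fst P" "e = energy a v" "S = osc_sin e" "C = osc_cos e"
  note defs = this
  define w w' where "w = denom a v" "w' = (\<lambda>t. - e * S t - fst v / a * C t)"
  note w_defs = this
  have a: "a > 0" using assms by (simp add: defs)
  have dw: "(w has_real_derivative w' t) (at t within I)" for t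
    using denom_DERIV[of a v t I] by (simp add: w_defs defs)
  have dw': "(w' has_real_derivative - e * w t) (at t within I)" for t
    using DERIV_diff[OF DERIV_cmult[OF osc_sin_DERIV[of e t I], of "- e"]
        DERIV_cmult[OF osc_cos_DERIV[of e t I], of "fst v / a"]]
    by (simp add: w_defs defs denom_def algebra_simps)
  have pos: "w t > 0" if "t \<in> I" for t using d[OF that] by (simp add: w_defs defs)
  \<comment> \<open>Conserved energy of the oscillator solution w, equal to its value at time 0. It
    expresses \<open>(snd v)\<^sup>2\<close> through w and w', which is what the equation for x''
    requires.\<close>
  have energy: "(snd v / a)\<^sup>2 = (w' t)\<^sup>2 + e * (w t)\<^sup>2" for t
  proof -
    have "(w' t)\<^sup>2 + e * (w t)\<^sup>2 = (e + (fst v / a)\<^sup>2) * ((C t)\<^sup>2 + e * (S t)\<^sup>2)"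
      by (simp add: w_defs denom_def defs algebra_simps power2_eq_square)
    also have "\<dots> = (snd v / a)\<^sup>2"
      using osc_pythagoras[of e t] by (simp add: defs energy_def power_divide diff_divide_distrib)
    finally show ?thesis by simp
  qed
  define \<gamma>' where "\<gamma>' = (\<lambda>t. (- a * w' t / (w t)\<^sup>2, snd v * (1 / (w t)\<^sup>2)))"
  have "geodesic_on I (geod P v) \<gamma>'"
    unfolding geodesic_on_components
  proof (intro ballI conjI)
    fix t assume t: "t \<in> I"
    note p = pos[OF t]
    have x: "fst (geod P v s) = a / w s" for s by (simp add: geod_def w_defs defs)
    have y: "snd (geod P v s) = snd P + snd v * (S s / w s)" for s
      by (simp add: geod_def w_defs defs)
    show "0 < fst (geod P v t)" using p a by (simp add: x)
    show "((\<lambda>t. fst (geod P v t)) has_real_derivative fst (\<gamma>' t)) (at t within I)"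
      unfolding x \<gamma>'_def
      by (rule derivative_eq_intros dw refl)+
        (use p in \<open>auto simp: field_simps power2_eq_square\<close>)
    have "((\<lambda>s. S s / w s) has_real_derivative 1 / (w t)\<^sup>2) (at t within I)"
      using osc_sin_over_denom_DERIV[of a v t I] p by (simp add: w_defs defs)
    from DERIV_add[OF DERIV_const DERIV_cmult[OF this]]
    show "((\<lambda>t. snd (geod P v t)) has_real_derivative snd (\<gamma>' t)) (at t within I)"
      unfolding y \<gamma>'_def snd_conv by (rule DERIV_cong) simp
    have v: "(snd v)\<^sup>2 = a\<^sup>2 * ((w' t)\<^sup>2 + e * (w t)\<^sup>2)"
      using energy[of t] a by (simp add: field_simps power_divide)
    have "((\<lambda>t. - a * w' t / (w t)\<^sup>2) has_real_derivative
        (a * e * w t * (w t)\<^sup>2 + 2 * a * w' t * w t * w' t) / ((w t)\<^sup>2 * (w t)\<^sup>2)) (at t within I)"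
      by (rule derivative_eq_intros dw dw' refl)+
        (use p in \<open>auto simp: algebra_simps\<close>)
    also have "(a * e * w t * (w t)\<^sup>2 + 2 * a * w' t * w t * w' t) / ((w t)\<^sup>2 * (w t)\<^sup>2)
      = ((- a * w' t / (w t)\<^sup>2)\<^sup>2 + (snd v)\<^sup>2 * (1 / (w t)\<^sup>2)\<^sup>2) / (a / w t)"
      unfolding v using p a by (simp add: field_simps power2_eq_square)
    finally show "((\<lambda>t. fst (\<gamma>' t)) has_real_derivative
        ((fst (\<gamma>' t))\<^sup>2 + (snd (\<gamma>' t))\<^sup>2) / fst (geod P v t)) (at t within I)"
      by (simp only: x \<gamma>'_def fst_conv snd_conv power_mult_distrib)
    have dinv: "((\<lambda>s. 1 / (w s)\<^sup>2) has_real_derivative - 2 * w' t / (w t) ^ 3) (at t within I)"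
      by (rule derivative_eq_intros dw refl)+
        (use p in \<open>auto simp: field_simps power2_eq_square power3_eq_cube\<close>)
    show "((\<lambda>t. snd (\<gamma>' t)) has_real_derivative
        2 * fst (\<gamma>' t) * snd (\<gamma>' t) / fst (geod P v t)) (at t within I)"
      unfolding x \<gamma>'_def fst_conv snd_conv
      by (rule DERIV_cong[OF DERIV_cmult[OF dinv]])
        (use p a in \<open>auto simp: field_simps power2_eq_square power3_eq_cube\<close>)
  qed
  moreover have "\<gamma>' 0 = v"
    using a by (simp add: \<gamma>'_def w_defs denom_def defs prod_eq_iff)
  ultimately show ?thesis by blast
qed

section \<open>The domain of the exponential map\<close>

text \<open>By the Wronskian identity the ratio \<open>denom / osc_sin\<close> has derivative - 1 /
  osc_sin^2, so it decreases while \<open>osc_sin\<close> is positive, and its sign at time 1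
  propagates back to all earlier positive times.\<close>

lemma denom_pos:
  assumes "energy a v < pi\<^sup>2" "denom a v 1 > 0" "t \<in> {0..1}"
  shows "denom a v t > 0"
proof (cases "t = 0")
  case True then show ?thesis by (simp add: denom_def)
next
  case False
  let ?S = "osc_sin (energy a v)"
  have S: "?S s > 0" if "s \<in> {t..1}" for s
    using osc_sin_pos[of "energy a v" s] assms that False by auto
  have "denom a v 1 / ?S 1 \<le> denom a v t / ?S t"
  proof (rule DERIV_nonpos_imp_nonincreasing[where f = "\<lambda>s. denom a v s / ?S s"])
    show "t \<le> 1" using assms by simp
    fix s assume "t \<le> s" "s \<le> 1"
    then have "?S s > 0" using S by simp
    then have "((\<lambda>s. denom a v s / ?S s) has_real_derivative
        ((- energy a v * ?S s - fst v / a * osc_cos (energy a v) s) * ?S s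
          - denom a v s * osc_cos (energy a v) s) / (?S s * ?S s)) (at s)"
      by (intro DERIV_divide denom_DERIV osc_sin_DERIV) auto
    also have "(- energy a v * ?S s - fst v / a * osc_cos (energy a v) s) * ?S s
          - denom a v s * osc_cos (energy a v) s = -1"
      using osc_denom_wronskian[of a v s] by (simp add: algebra_simps)
    finally show "\<exists>d. ((\<lambda>s. denom a v s / ?S s) has_real_derivative d) (at s) \<and> d \<le> 0"
      using \<open>?S s > 0\<close> by (intro exI[of _ "-1 / (?S s * ?S s)"]) auto
  qed
  moreover have "denom a v 1 / ?S 1 > 0" using S[of 1] assms by simp
  ultimately have "denom a v t / ?S t > 0" by linarith
  then show ?thesis using S[of t] assms by (simp add: zero_less_divide_iff)
qed

lemma exp_dom_eq:
  assumes "P \<in> M"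
  shows "exp_dom P = {v. energy (fst P) v < pi\<^sup>2 \<and> denom (fst P) v 1 > 0}"
proof (intro set_eqI iffI)
  fix v assume "v \<in> exp_dom P"
  then obtain \<gamma> \<gamma>' where g: "geodesic_on {0..1} \<gamma> \<gamma>'" "\<gamma> 0 = P" "\<gamma>' 0 = v"
    unfolding exp_dom_def by auto
  have d: "denom (fst P) v t > 0" if "t \<in> {0..1}" for t
    using geodesic_is_geod(1)[OF g(1) that] g by simp
  have "energy (fst P) v < pi\<^sup>2"
  proof (rule ccontr)
    let ?e = "energy (fst P) v"
    assume "\<not> ?e < pi\<^sup>2"
    then have e: "?e \<ge> pi\<^sup>2" by simp
    then have "?e > 0" using pi_gt_zero by (smt (verit) zero_less_power)
    \<comment> \<open>Here e t^2 = pi^2, so the sine term vanishes and the cosine is -1: the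
      denominator is negative at a time in the unit interval.\<close>
    define t where "t = pi / sqrt ?e"
    have t2: "?e * t\<^sup>2 = pi\<^sup>2" using \<open>?e > 0\<close> by (simp add: t_def power_divide)
    have "pi \<le> sqrt ?e" using e real_le_rsqrt by blast
    then have "t \<in> {0..1}" using \<open>?e > 0\<close> by (simp add: t_def)
    moreover have "denom (fst P) v t = -1"
      using sincq_square[of pi] cosq_square[of pi]
      by (simp add: denom_def osc_cos_def osc_sin_def t2)
    ultimately show False using d by force
  qed
  then show "v \<in> {v. energy (fst P) v < pi\<^sup>2 \<and> denom (fst P) v 1 > 0}" using d by simp
next
  fix v assume v: "v \<in> {v. energy (fst P) v < pi\<^sup>2 \<and> denom (fst P) v 1 > 0}"
  have "geod P v 0 = P" by (simp add: geod_def denom_def)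
  then show "v \<in> exp_dom P"
    using geodesic_on_geod[of P "{0..1}" v] denom_pos v assms unfolding exp_dom_def M_def by blast
qed

text \<open>Every geodesic with the given initial data agrees with \<open>geod\<close>, so the value
  at time 1 does not depend on the choice made by \<open>SOME\<close>.\<close>

lemma expmap_eq:
  assumes "v \<in> exp_dom P"
  shows "expmap P v = geod P v 1"
proof -
  let ?Q = "\<lambda>\<gamma>. \<exists>\<gamma>'. geodesic_on {0..1} \<gamma> \<gamma>' \<and> \<gamma> 0 = P \<and> \<gamma>' 0 = v"
  have "\<exists>\<gamma>. ?Q \<gamma>" using assms by (simp add: exp_dom_def)
  then have "?Q (SOME \<gamma>. ?Q \<gamma>)" by (rule someI_ex)
  then obtain \<gamma>' where "geodesic_on {0..1} (SOME \<gamma>. ?Q \<gamma>) \<gamma>'"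
      "(SOME \<gamma>. ?Q \<gamma>) 0 = P" "\<gamma>' 0 = v"
    by blast
  then show ?thesis
    unfolding expmap_def using geodesic_is_geod(2)[of "SOME \<gamma>. ?Q \<gamma>" \<gamma>' 1] by simp
qed

section \<open>Smoothness of the exponential map\<close>

text \<open>An algebra of functions containing the components of the exponential map and closed under
  directional derivatives where the denominator does not vanish, used as coinduction invariant for
  smoothness. The base point of the geodesics enters only through its first coordinate \<open>a\<close>.\<close>

inductive_set jets :: "real \<Rightarrow> (real \<times> real \<Rightarrow> real) set" for a where
  jets_const: "(\<lambda>_. c) \<in> jets a"
| jets_fst: "fst \<in> jets a"
| jets_snd: "snd \<in> jets a"
| jets_cosq: "(\<lambda>v. cosq_deriv k (energy a v)) \<in> jets a"
| jets_inverse_denom: "(\<lambda>v. 1 / denom a v 1) \<in> jets a"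
| jets_add: "f \<in> jets a \<Longrightarrow> g \<in> jets a \<Longrightarrow> (\<lambda>v. f v + g v) \<in> jets a"
| jets_mult: "f \<in> jets a \<Longrightarrow> g \<in> jets a \<Longrightarrow> (\<lambda>v. f v * g v) \<in> jets a"

lemma denom_at_1: "denom a v 1 = cosq (energy a v) - fst v / a * sincq (energy a v)"
  by (simp add: denom_def osc_cos_def osc_sin_def)

text \<open>The derivative is written with \<open>(-1) *\<close> instead of a difference so that it
  is built from the sums and products that generate \<open>jets\<close>.\<close>

lemma energy_has_derivative:
  "(energy a has_derivative (\<lambda>u. 2 / a\<^sup>2 * (snd v * snd u + (-1) * (fst v * fst u)))) (at v)"
proof -
  have "((\<lambda>v. (snd v * snd v - fst v * fst v) * (1 / a\<^sup>2)) has_derivative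
      (\<lambda>u. (snd v * snd u + snd u * snd v - (fst v * fst u + fst u * fst v)) * (1 / a\<^sup>2))) (at v)"
    by (intro has_derivative_mult_left has_derivative_diff has_derivative_mult has_derivative_fst
        has_derivative_snd has_derivative_ident)
  moreover have "energy a = (\<lambda>v. (snd v * snd v - fst v * fst v) * (1 / a\<^sup>2))"
    by (simp add: fun_eq_iff energy_def power2_eq_square)
  moreover have "(\<lambda>u. (snd v * snd u + snd u * snd v - (fst v * fst u + fst u * fst v)) * (1 / a\<^sup>2)) =
      (\<lambda>u. 2 / a\<^sup>2 * (snd v * snd u + (-1) * (fst v * fst u)))"
    by (simp add: fun_eq_iff algebra_simps)
  ultimately show ?thesis by simp
qed

lemma cosq_energy_has_derivative:
  "((\<lambda>v. cosq_deriv k (energy a v)) has_derivative (\<lambda>u. 2 / a\<^sup>2 *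
     (snd v * snd u + (-1) * (fst v * fst u)) * cosq_deriv (Suc k) (energy a v))) (at v)"
  by (rule DERIV_compose_FDERIV[OF cosq_deriv_has_derivative energy_has_derivative])

lemma denom_has_derivative:
  obtains D where "\<And>v. ((\<lambda>v. denom a v 1) has_derivative D v) (at v)"
    "\<And>u. (\<lambda>v. D v u) \<in> jets a"
proof -
  define E where "E = (\<lambda>v u. 2 / a\<^sup>2 * (snd v * snd u + (-1) * (fst v * fst u)))"
  define D where "D = (\<lambda>v u. E v u * cosq_deriv 1 (energy a v) + 2 / a *
    (fst v * (E v u * cosq_deriv 2 (energy a v)) + fst u * cosq_deriv 1 (energy a v)))"
  have c0: "((\<lambda>v. cosq (energy a v)) has_derivative
      (\<lambda>u. E v u * cosq_deriv 1 (energy a v))) (at v)" for v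
    using cosq_energy_has_derivative[of 0 a v] by (simp only: E_def One_nat_def)
  have c1: "((\<lambda>v. cosq_deriv 1 (energy a v)) has_derivative
      (\<lambda>u. E v u * cosq_deriv 2 (energy a v))) (at v)" for v
    using cosq_energy_has_derivative[of 1 a v] by (simp only: E_def One_nat_def numeral_2_eq_2)
  have "((\<lambda>v. cosq (energy a v) + 2 / a * (fst v * cosq_deriv 1 (energy a v)))
      has_derivative D v) (at v)" for v
    unfolding D_def
    by (intro has_derivative_add has_derivative_mult_right has_derivative_mult has_derivative_fst
        has_derivative_ident c0 c1)
  then have "((\<lambda>v. denom a v 1) has_derivative D v) (at v)" for v
    by (simp add: denom_at_1 sincq_def mult_ac)
  moreover have "(\<lambda>v. D v u) \<in> jets a" for u
    unfolding D_def E_def by (intro jets.intros)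
  ultimately show thesis by (rule that)
qed

text \<open>Induction over the generators, by the sum and product rules. The derivative
  \<open>D\<close> is chosen as one explicit expression, so that for each fixed direction u it is
  again in the algebra; only the reciprocal of \<open>denom\<close> forces the restriction on
  v.\<close>

lemma jets_has_derivative:
  assumes "f \<in> jets a"
  shows "\<exists>D. (\<forall>v. denom a v 1 \<noteq> 0 \<longrightarrow> (f has_derivative D v) (at v)) \<and>
    (\<forall>u. (\<lambda>v. D v u) \<in> jets a)"
  using assms
proof induction
  case (jets_const c)
  show ?case by (intro exI[of _ "\<lambda>_ _. 0"]) (auto intro: jets.intros)
next
  case jets_fst
  show ?case
    by (intro exI[of _ "\<lambda>_. fst"]) (auto intro: jets.intros derivative_intros)
next
  case jets_snd
  show ?case
    by (intro exI[of _ "\<lambda>_. snd"]) (auto intro: jets.intros derivative_intros)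
next
  case (jets_cosq k)
  show ?case
    by (intro exI conjI allI impI, rule cosq_energy_has_derivative) (intro jets.intros)
next
  case jets_inverse_denom
  obtain D where D: "\<And>v. ((\<lambda>v. denom a v 1) has_derivative D v) (at v)"
    "\<And>u. (\<lambda>v. D v u) \<in> jets a" using denom_has_derivative[of a] by blast
  show ?case
  proof (intro exI[of _ "\<lambda>v u. (-1) * (1 / denom a v 1 * (D v u * (1 / denom a v 1)))"]
      conjI allI impI)
    fix v assume "denom a v 1 \<noteq> 0"
    from Deriv.has_derivative_inverse[OF this D(1)]
    show "((\<lambda>v. 1 / denom a v 1) has_derivative
        (\<lambda>u. (-1) * (1 / denom a v 1 * (D v u * (1 / denom a v 1))))) (at v)"
      by (simp add: inverse_eq_divide)
  qed (intro jets.intros D)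
next
  case (jets_add f g)
  then obtain Df Dg where
    "\<forall>v. denom a v 1 \<noteq> 0 \<longrightarrow> (f has_derivative Df v) (at v)" "\<forall>u. (\<lambda>v. Df v u) \<in> jets a"
    "\<forall>v. denom a v 1 \<noteq> 0 \<longrightarrow> (g has_derivative Dg v) (at v)" "\<forall>u. (\<lambda>v. Dg v u) \<in> jets a"
    by blast
  then show ?case
    by (intro exI[of _ "\<lambda>v u. Df v u + Dg v u"])
      (auto intro!: jets.intros has_derivative_add)
next
  case (jets_mult f g)
  then obtain Df Dg where
    "\<forall>v. denom a v 1 \<noteq> 0 \<longrightarrow> (f has_derivative Df v) (at v)" "\<forall>u. (\<lambda>v. Df v u) \<in> jets a"
    "\<forall>v. denom a v 1 \<noteq> 0 \<longrightarrow> (g has_derivative Dg v) (at v)" "\<forall>u. (\<lambda>v. Dg v u) \<in> jets a"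
    by blast
  then show ?case
    using jets_mult.hyps
    by (intro exI[of _ "\<lambda>v u. f v * Dg v u + Df v u * g v"])
      (auto intro!: jets.intros has_derivative_mult)
qed

text \<open>Coinduction with the invariant that both components agree on S with members of
  \<open>jets\<close>. Agreement on S is enough because S is open: derivatives at points of S then
  agree too, so the invariant passes to every directional derivative.\<close>

lemma smooth_on_jets:
  assumes "open S" and S: "\<And>v. v \<in> S \<Longrightarrow> denom a v 1 \<noteq> 0"
    and "g \<in> jets a" "h \<in> jets a" "\<And>v. v \<in> S \<Longrightarrow> f v = (g v, h v)"
  shows "smooth_on S f"
proof -
  have "\<exists>g\<in>jets a. \<exists>h\<in>jets a. \<forall>v\<in>S. f v = (g v, h v)" using assms by blast
  then show ?thesis
  proof (coinduction arbitrary: f)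
    case smooth_on
    then obtain g h where gh: "g \<in> jets a" "h \<in> jets a" "\<forall>v\<in>S. f v = (g v, h v)" by blast
    obtain Dg Dh where
      D: "\<forall>v. denom a v 1 \<noteq> 0 \<longrightarrow> (g has_derivative Dg v) (at v)" "\<forall>u. (\<lambda>v. Dg v u) \<in> jets a"
      "\<forall>v. denom a v 1 \<noteq> 0 \<longrightarrow> (h has_derivative Dh v) (at v)" "\<forall>u. (\<lambda>v. Dh v u) \<in> jets a"
      using jets_has_derivative[OF gh(1)] jets_has_derivative[OF gh(2)] by blast
    have df: "(f has_derivative (\<lambda>u. (Dg v u, Dh v u))) (at v)" if "v \<in> S" for v
    proof (rule has_derivative_transform_within_open[OF _ assms(1) that])
      show "((\<lambda>v. (g v, h v)) has_derivative (\<lambda>u. (Dg v u, Dh v u))) (at v)"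
        using D(1,3) S[OF that] by (intro has_derivative_Pair) blast+
    qed (use gh in auto)
    then have fr: "frechet_derivative f (at v) = (\<lambda>u. (Dg v u, Dh v u))" if "v \<in> S" for v
      using frechet_derivative_at that by metis
    have "\<exists>g\<in>jets a. \<exists>h\<in>jets a. \<forall>v\<in>S. frechet_derivative f (at v) u = (g v, h v)" for u
      by (rule bexI[of _ "\<lambda>v. Dg v u"], rule bexI[of _ "\<lambda>v. Dh v u"])
        (simp_all add: fr D(2,4)[rule_format])
    moreover have "\<forall>x\<in>S. f differentiable (at x)"
      using df differentiableI by blast
    ultimately show ?case by blast
  qed
qed

lemma open_exp_dom:
  assumes "P \<in> M" shows "open (exp_dom P)"
proof -
  obtain D where "\<And>v. ((\<lambda>v. denom (fst P) v 1) has_derivative D v) (at v)"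
    using denom_has_derivative by blast
  then have "continuous_on UNIV (\<lambda>v. denom (fst P) v 1)"
    by (meson continuous_at_imp_continuous_on has_derivative_continuous)
  moreover have "continuous_on UNIV (energy (fst P))"
    by (meson continuous_at_imp_continuous_on has_derivative_continuous energy_has_derivative)
  ultimately show ?thesis
    unfolding exp_dom_eq[OF assms]
    by (intro open_Collect_conj open_Collect_less continuous_on_const)
qed

lemma geod_at_1_jets:
  "geod P v 1 = (fst P * (1 / denom (fst P) v 1),
     snd P + snd v * ((-2) * cosq_deriv 1 (energy (fst P) v)) * (1 / denom (fst P) v 1))"
  by (simp add: geod_def osc_sin_def sincq_def)

lemma smooth_on_expmap:
  assumes "P \<in> M" shows "smooth_on (exp_dom P) (expmap P)"
proof (rule smooth_on_jets[OF open_exp_dom[OF assms]])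
  show "denom (fst P) v 1 \<noteq> 0" if "v \<in> exp_dom P" for v
    using that by (simp add: exp_dom_eq[OF assms])
  show "(\<lambda>v. fst P * (1 / denom (fst P) v 1)) \<in> jets (fst P)" by (intro jets.intros)
  show "(\<lambda>v. snd P + snd v * ((-2) * cosq_deriv 1 (energy (fst P) v)) * (1 / denom (fst P) v 1))
      \<in> jets (fst P)"
    by (intro jets.intros)
qed (simp add: expmap_eq geod_at_1_jets)

section \<open>Injectivity of the exponential map and of its differential\<close>

text \<open>With A = v1 S / a and B = v2 S / a one has e S^2 = B^2 - A^2, so the Pythagorean
  relation reads C^2 + B^2 - A^2 = 1; now substitute A = C - W.\<close>

lemma denom_cosq_identity:
  "2 * denom a v 1 * cosq (energy a v) =
     1 + (denom a v 1)\<^sup>2 - (snd v / a * sincq (energy a v))\<^sup>2"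
  using cosq_sincq_pythagoras[of "energy a v"]
  by (simp add: denom_at_1 energy_def power2_eq_square algebra_simps diff_divide_distrib add_divide_distrib)

lemma geod_at_1:
  "geod P v 1 = (fst P / denom (fst P) v 1,
     snd P + snd v * sincq (energy (fst P) v) / denom (fst P) v 1)"
  by (simp add: geod_def osc_sin_def)

lemma inj_on_expmap:
  assumes "P \<in> M" shows "inj_on (expmap P) (exp_dom P)"
proof (rule inj_onI)
  fix v w assume vw: "v \<in> exp_dom P" "w \<in> exp_dom P" "expmap P v = expmap P w"
  define a where "a = fst P"
  have a: "a > 0" using assms by (simp add: M_def a_def)
  have dom: "energy a v < pi\<^sup>2" "denom a v 1 > 0" "energy a w < pi\<^sup>2" "denom a w 1 > 0"
    using vw by (auto simp: exp_dom_eq[OF assms] a_def)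
  have "a / denom a v 1 = a / denom a w 1"
    "snd v * sincq (energy a v) / denom a v 1 = snd w * sincq (energy a w) / denom a w 1"
    using vw by (auto simp: expmap_eq geod_at_1 a_def)
  then have W: "denom a v 1 = denom a w 1"
    and B: "snd v * sincq (energy a v) = snd w * sincq (energy a w)"
    using a dom by (auto simp: field_simps)
  have "2 * denom a v 1 * cosq (energy a v) = 2 * denom a v 1 * cosq (energy a w)"
    using denom_cosq_identity[of a v] denom_cosq_identity[of a w] W B by simp
  then have C: "cosq (energy a v) = cosq (energy a w)" using dom by simp
  then have e: "energy a v = energy a w"
    using cosq_strict_antimono dom by (metis less_irrefl linorder_less_linear)
  \<comment> \<open>Once the energies agree, B determines the second component of the vector and W -
    C the first, after division by the common positive factor.\<close>
  have "sincq (energy a w) > 0" using dom sincq_pos by simp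
  then show "v = w"
    using W B C a by (simp add: denom_at_1 e prod_eq_iff)
qed

text \<open>Restricting to the line through v in direction u reduces the claim to one-variable
  calculus at 0. The steps of the injectivity proof are repeated for derivatives: W' = 0 and B' = 0
  force C' = 0, hence e' = 0, S' = 0 and u = 0.\<close>

lemma geod_derivative_injective:
  assumes "fst P > 0" and dom: "energy (fst P) v < pi\<^sup>2" "denom (fst P) v 1 > 0"
    and F: "((\<lambda>v. geod P v 1) has_derivative F) (at v)" and "F u = 0"
  shows "u = 0"
proof -
  define a where "a = fst P"
  have a: "a > 0" using assms by (simp add: a_def)
  let ?l = "\<lambda>t. v + t *\<^sub>R u"
  have l: "(?l has_derivative (\<lambda>t. t *\<^sub>R u)) (at 0)"
    by (auto intro!: derivative_eq_intros)
  have "((\<lambda>t. geod P (?l t) 1) has_derivative (\<lambda>t. F (t *\<^sub>R u))) (at 0)"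
    using has_derivative_compose[OF l, of "\<lambda>v. geod P v 1" F] F by simp
  moreover have "F (t *\<^sub>R u) = 0" for t
    using has_derivative_bounded_linear[OF F] \<open>F u = 0\<close> by (simp add: linear_simps)
  ultimately have G: "((\<lambda>t. geod P (?l t) 1) has_derivative (\<lambda>t. 0)) (at 0)" by simp
  define E where "E = (\<lambda>t. energy a (?l t))"
  define W where "W = (\<lambda>t. denom a (?l t) 1)"
  define S where "S = (\<lambda>t. sincq (E t))"
  define C where "C = (\<lambda>t. cosq (E t))"
  define B where "B = (\<lambda>t. (snd v + t * snd u) / a * S t)"
  define A where "A = (\<lambda>t. (fst v + t * fst u) / a * S t)"
  note defs = E_def W_def S_def C_def B_def A_def
  have WCA: "W = (\<lambda>t. C t - A t)" by (auto simp: defs denom_at_1)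
  obtain e' where E': "(E has_real_derivative e') (at 0)"
  proof -
    have "(E has_derivative (\<lambda>t. 2 / a\<^sup>2 * (snd v * snd (t *\<^sub>R u) + (-1) * (fst v * fst (t *\<^sub>R u))))) (at 0)"
      unfolding E_def using energy_has_derivative[of a v]
      by (intro has_derivative_compose[OF l, of "energy a"]) simp
    also have "(\<lambda>t. 2 / a\<^sup>2 * (snd v * snd (t *\<^sub>R u) + (-1) * (fst v * fst (t *\<^sub>R u)))) =
        (*) (2 / a\<^sup>2 * (snd v * snd u - fst v * fst u))"
      by (simp add: fun_eq_iff algebra_simps)
    finally show thesis
      by (intro that[of "2 / a\<^sup>2 * (snd v * snd u - fst v * fst u)"])
        (simp only: has_field_derivative_def)
  qed
  have S': "(S has_real_derivative -2 * cosq_deriv 2 (E 0) * e') (at 0)"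
    unfolding S_def using sincq_DERIV[OF E'] .
  have C': "(C has_real_derivative - S 0 / 2 * e') (at 0)"
    unfolding C_def using cosq_DERIV[OF E'] by (simp add: S_def)
  have aff: "((\<lambda>t. (x + t * y) / a) has_real_derivative y / a) (at 0)" for x y
    using a by (auto intro!: derivative_eq_intros)
  define s' where "s' = -2 * cosq_deriv 2 (E 0) * e'"
  define c' where "c' = - S 0 / 2 * e'"
  define b' where "b' = snd u / a * S 0 + s' * (snd v / a)"
  define a' where "a' = fst u / a * S 0 + s' * (fst v / a)"
  have B': "(B has_real_derivative b') (at 0)"
    unfolding B_def using DERIV_mult[OF aff S'] by (simp add: b'_def s'_def)
  have A': "(A has_real_derivative a') (at 0)"
    unfolding A_def using DERIV_mult[OF aff S'] by (simp add: a'_def s'_def)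
  have W': "(W has_real_derivative c' - a') (at 0)"
    unfolding WCA using DERIV_diff[OF C' A'] by (simp add: c'_def)
  have W0: "W 0 > 0" and S0: "S 0 > 0"
    using dom sincq_pos by (auto simp: defs a_def)
  have "((\<lambda>t. a / W t) has_real_derivative 0) (at 0)"
    using has_derivative_fst[OF G]
    by (simp add: geod_at_1 W_def a_def has_field_derivative_def flip: lambda_zero)
  moreover have "((\<lambda>t. a / W t) has_real_derivative - a * (c' - a') / (W 0 * W 0)) (at 0)"
    using DERIV_divide[OF DERIV_const W', of a] W0 by simp
  ultimately have w0: "c' - a' = 0"
    using DERIV_unique a W0 by fastforce
  have "((\<lambda>t. B t / W t) has_real_derivative 0) (at 0)"
  proof -
    have "((\<lambda>t. snd (geod P (?l t) 1)) has_real_derivative 0) (at 0)"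
      using has_derivative_snd[OF G] by (simp add: has_field_derivative_def flip: lambda_zero)
    from DERIV_cdivide[OF DERIV_diff[OF this DERIV_const], of "snd P" a]
    have "((\<lambda>t. (snd (geod P (?l t) 1) - snd P) / a) has_real_derivative 0) (at 0)" by simp
    moreover have "(\<lambda>t. (snd (geod P (?l t) 1) - snd P) / a) = (\<lambda>t. B t / W t)"
      by (simp add: geod_at_1 defs a_def mult.commute)
    ultimately show ?thesis by simp
  qed
  moreover have "((\<lambda>t. B t / W t) has_real_derivative (b' * W 0 - B 0 * (c' - a')) / (W 0 * W 0)) (at 0)"
    using DERIV_divide[OF B' W'] W0 by simp
  ultimately have b0: "b' = 0"
    using DERIV_unique W0 w0 by fastforce
  \<comment> \<open>The identity between W, C and B holds along the whole line. Differentiating it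
    at 0 with W' = B' = 0 leaves 2 W C' = 0.\<close>
  have "(\<lambda>t. 2 * (W t * C t) - (W t * W t - B t * B t)) = (\<lambda>t. 1)"
  proof
    fix t
    show "2 * (W t * C t) - (W t * W t - B t * B t) = 1"
      using denom_cosq_identity[of a "?l t"] by (simp add: defs power2_eq_square)
  qed
  then have "((\<lambda>t. 2 * (W t * C t) - (W t * W t - B t * B t)) has_real_derivative 0) (at 0)"
    by simp
  moreover have "((\<lambda>t. 2 * (W t * C t) - (W t * W t - B t * B t)) has_real_derivative
      2 * ((c' - a') * C 0 + c' * W 0) - (((c' - a') * W 0 + (c' - a') * W 0) - (b' * B 0 + b' * B 0))) (at 0)"
    unfolding c'_def by (intro DERIV_diff DERIV_cmult DERIV_mult W'[unfolded c'_def] C' B')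
  ultimately have "c' = 0"
    using DERIV_unique w0 b0 W0 by fastforce
  then have "s' = 0" using S0 by (simp add: c'_def s'_def)
  then have "fst u = 0" "snd u = 0"
    using \<open>c' = 0\<close> w0 b0 S0 a by (auto simp: a'_def b'_def)
  then show "u = 0" by (simp add: prod_eq_iff)
qed

lemma inj_frechet_derivative_expmap:
  assumes "P \<in> M" "v \<in> exp_dom P"
  shows "inj (frechet_derivative (expmap P) (at v))"
proof -
  let ?F = "frechet_derivative (expmap P) (at v)"
  have "expmap P differentiable (at v)"
    using smooth_on_expmap[OF assms(1)] assms(2) by (auto elim: smooth_on.cases)
  then have F: "(expmap P has_derivative ?F) (at v)"
    by (simp add: frechet_derivative_works)
  \<comment> \<open>\<open>expmap P\<close> and the closed form agree only on the domain; openness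
    of the domain lets the derivative pass from one to the other.\<close>
  have "((\<lambda>v. geod P v 1) has_derivative ?F) (at v)"
    using has_derivative_transform_within_open[OF F open_exp_dom[OF assms(1)] assms(2),
        of "\<lambda>v. geod P v 1"] expmap_eq
    by blast
  then have "?F u = 0 \<Longrightarrow> u = 0" for u
    using geod_derivative_injective assms unfolding exp_dom_eq[OF assms(1)] M_def by blast
  then show ?thesis
    using linear_injective_0[OF has_derivative_linear[OF F]] by blast
qed

section \<open>The embedding and the bound on its image\<close>

lemma smooth_embedding_expmap:
  assumes "P \<in> M" shows "smooth_embedding (exp_dom P) (expmap P)"
proof -
  have "continuous_on (exp_dom P) (expmap P)"
    using smooth_on_expmap[OF assms]
    by (auto elim!: smooth_on.cases intro!: continuous_at_imp_continuous_on differentiable_imp_continuous_within)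
  then have "\<exists>g. homeomorphism (exp_dom P) (expmap P ` exp_dom P) (expmap P) g"
    using invariance_of_domain_homeomorphism[OF open_exp_dom[OF assms] _ _ inj_on_expmap[OF assms]]
    by auto
  then show ?thesis
    using smooth_on_expmap inj_frechet_derivative_expmap assms
    by (simp add: smooth_embedding_def)
qed

text \<open>From C > -1 and W > 0 the identity gives B^2 = 1 + W^2 - 2 W C < (1 + W)^2.\<close>

lemma expmap_image_bound:
  assumes "P \<in> M" "v \<in> exp_dom P"
  shows "\<bar>snd (expmap P v) - snd P\<bar> < fst P + fst (expmap P v)"
proof -
  define a where "a = fst P"
  define W where "W = denom a v 1"
  define B where "B = snd v / a * sincq (energy a v)"
  have a: "a > 0" using assms by (simp add: M_def a_def)
  have dom: "energy a v < pi\<^sup>2" "W > 0"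
    using assms by (auto simp: exp_dom_eq a_def W_def)
  then have "2 * W * -1 < 2 * W * cosq (energy a v)"
    using cosq_gt_minus_one by (intro mult_strict_left_mono) auto
  then have "B\<^sup>2 < (1 + W)\<^sup>2"
    using denom_cosq_identity[of a v]
    by (simp add: W_def B_def power2_eq_square algebra_simps)
  then have "\<bar>B\<bar> < 1 + W" using dom power2_less_imp_less[of "\<bar>B\<bar>" "1 + W"] by simp
  \<comment> \<open>Scaling by a / W turns B into the displacement in the second coordinate and 1 +
    W into the sum of the two first coordinates.\<close>
  then have "a / W * \<bar>B\<bar> < a / W * (1 + W)"
    using a dom by (intro mult_strict_left_mono) auto
  moreover have "\<bar>snd (expmap P v) - snd P\<bar> = a / W * \<bar>B\<bar>"
    using a dom assms by (simp add: expmap_eq geod_at_1 W_def B_def a_def abs_mult)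
  moreover have "a / W * (1 + W) = fst P + fst (expmap P v)"
    using dom assms by (simp add: expmap_eq geod_at_1 W_def a_def field_simps)
  ultimately show ?thesis by simp
qed

theorem theorem5p1:
  shows "(\<forall>P\<in>M. smooth_embedding (exp_dom P) (expmap P))
    \<and> (\<forall>P\<in>M. \<exists>U. open U \<and> U \<noteq> {} \<and> U \<subseteq> M \<and> U \<inter> expmap P ` exp_dom P = {})
    \<and> (\<forall>v\<in>exp_dom (1, 0). let Q = expmap (1, 0) v in
         \<not> (snd Q \<ge> 1 + fst Q) \<and> \<not> (snd Q \<le> -1 - fst Q))"
proof (intro conjI ballI)
  fix P assume P: "P \<in> M"
  then show "smooth_embedding (exp_dom P) (expmap P)" by (rule smooth_embedding_expmap)
  \<comment> \<open>The upper of the two regions excluded by the image bound, taken with a strict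
    inequality to be open.\<close>
  let ?U = "{Q. 0 < fst Q \<and> snd P + fst P + fst Q < snd Q}"
  have "open ?U"
    by (intro open_Collect_conj open_Collect_less continuous_intros)
  moreover have "(1, snd P + fst P + 2) \<in> ?U" by simp
  moreover have "?U \<subseteq> M" by (auto simp: M_def)
  moreover have "?U \<inter> expmap P ` exp_dom P = {}"
    using expmap_image_bound[OF P] by fastforce
  ultimately show "\<exists>U. open U \<and> U \<noteq> {} \<and> U \<subseteq> M \<and> U \<inter> expmap P ` exp_dom P = {}"
    by blast
next
  fix v assume "v \<in> exp_dom (1, 0)"
  then have "\<bar>snd (expmap (1, 0) v) - 0\<bar> < 1 + fst (expmap (1, 0) v)"
    using expmap_image_bound[of "(1, 0)" v] by (simp add: M_def)
  then show "let Q = expmap (1, 0) v in \<not> (snd Q \<ge> 1 + fst Q) \<and> \<not> (snd Q \<le> -1 - fst Q)"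
    by (simp add: Let_def abs_less_iff)
qed

end
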